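(* Let $d\ge1$, and let $\hat c:\mathbb{R}\to\mathbb{R}$ be an even function, whose restriction to $[0,\infty)$ is an admissible univariate function of type (a), satisfying $0\le\hat c\le1$. Define $\mathcal{N}:\mathbb{R}^d\to\mathbb{R}$ by $\mathcal{N}(0)=0$ and $$\mathcal{N}(t)=\sum_{m=1}^d|t_m|\prod_{j=1}^d\hat c\Big(\frac{t_j}{t_m}\Big),\quad t\ne0,$$ where $\hat c(\tau/0):=0$ for every real $\tau$, including $\tau=0$. If $\hat a$ is an admissible univariate function of type (a), (b) or (c), then $$\hat A(t)=\hat a(\mathcal{N}(t)),\quad t\in[0,\infty)^d,$$ is an admissible $d$-dimensional function of second kind and type (a), (b) or (c), respectively.
   Context: A univariate function $\hat a\in C^\infty[0,\infty)$ is admissible if $\operatorname{supp}\hat a\subset[0,2]$ and $\hat a^{(m)}(0)=0$ for $m\ge1$. It is of type (a) if in addition $\hat a(t)=1$ for $t\in[0,1]$; of type (b) if in addition $\operatorname{supp}\hat a\subset[1/2,2]$; of type (c) if in addition $\operatorname{supp}\hat a\subset[1/2,2]$ and $\sum_{j=0}^\infty|\hat a(2^{-j}t)|^2=1$ for $t\in[1,\infty)$. Let $\operatorname{proj}_k t$ denote $t\in\mathbb{R}^d$ with its $k$th coordinate replaced by $0$, and $\mathcal{B}_1=\{t\in[0,\infty)^d:\|t\|_1\le1\}$. A function $\hat A\in C^\infty[0,\infty)^d$ is an admissible ($d$-dimensional) cutoff function of second kind and type (a), (b) or (c) if $\operatorname{supp}\hat A\subset[0,2]^d$, $\hat A(t)=\hat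 A(\operatorname{proj}_k t)$ for every $t\in[0,\infty)^d$ and every $k$ such that $t_k\le\frac12\|t\|_\infty$, and, respectively: (a) $\hat A(t)=1$ if $t\in\mathcal{B}_1$; (b) $\hat A(t)=0$ if $t\in\frac12\mathcal{B}_1$; (c) $\hat A$ is of type (b) and $\sum_{j=0}^\infty|\hat A(2^{-j}t)|^2=1$ for $t\in[0,\infty)^d\setminus[0,1)^d$. *)

theory Defs
  imports "HOL-Analysis.Analysis"
begin

text \<open>
  Functions on \<open>[0,\<infinity>)\<close> and \<open>[0,\<infinity>)\<^sup>d\<close> are represented by total functions on \<open>real\<close> and
  \<open>real^'n\<close> (with \<open>d = CARD('n)\<close>); every predicate below depends only on the values on
  \<open>[0,\<infinity>)\<close> and \<open>[0,\<infinity>)\<^sup>d\<close>, respectively. The values of cutoff functions lie in an arbitrary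
  real normed field, which covers real- and complex-valued cutoff functions alike.
\<close>

text \<open>
  All derivatives are relative to the set \<open>S\<close>, i.e. one-sided at its boundary. For the sets used
  here, \<open>[0,\<infinity>)\<close> and \<open>[0,\<infinity>)\<^sup>d\<close>, they are uniquely determined at every point of \<open>S\<close>, so that the
  existential quantifier picks the derivative.
\<close>

primrec C_k_on :: "nat \<Rightarrow> 'a::euclidean_space set \<Rightarrow> ('a \<Rightarrow> 'b::real_normed_vector) \<Rightarrow> bool" where
  "C_k_on 0 S f \<longleftrightarrow> continuous_on S f"
| "C_k_on (Suc k) S f \<longleftrightarrow>
     (\<exists>f'. (\<forall>x\<in>S. (f has_derivative f' x) (at x within S)) \<and>
           (\<forall>i\<in>Basis. C_k_on k S (\<lambda>x. f' x i)))"

definition C_infinity_on :: "'a::euclidean_space set \<Rightarrow> ('a \<Rightarrow> 'b::real_normed_vector) \<Rightarrow> bool" where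
  "C_infinity_on S f \<longleftrightarrow> (\<forall>k. C_k_on k S f)"

definition supp_on :: "'a::topological_space set \<Rightarrow> ('a \<Rightarrow> 'b::zero) \<Rightarrow> 'a set" where
  "supp_on S f = closure {t \<in> S. f t \<noteq> 0}"

definition nth_deriv :: "nat \<Rightarrow> (real \<Rightarrow> 'b::real_normed_vector) \<Rightarrow> real \<Rightarrow> 'b" where
  "nth_deriv m f = ((\<lambda>g t. vector_derivative g (at t within {0..})) ^^ m) f"

definition admissible :: "(real \<Rightarrow> 'b::real_normed_field) \<Rightarrow> bool" where
  "admissible a \<longleftrightarrow>
     C_infinity_on {0..} a \<and> supp_on {0..} a \<subseteq> {0..2} \<and> (\<forall>m\<ge>1. nth_deriv m a 0 = 0)"

definition admissible_a :: "(real \<Rightarrow> 'b::real_normed_field) \<Rightarrow> bool" where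
  "admissible_a a \<longleftrightarrow> admissible a \<and> (\<forall>t\<in>{0..1}. a t = 1)"

definition admissible_b :: "(real \<Rightarrow> 'b::real_normed_field) \<Rightarrow> bool" where
  "admissible_b a \<longleftrightarrow> admissible a \<and> supp_on {0..} a \<subseteq> {1/2..2}"

definition admissible_c :: "(real \<Rightarrow> 'b::real_normed_field) \<Rightarrow> bool" where
  "admissible_c a \<longleftrightarrow> admissible a \<and> supp_on {0..} a \<subseteq> {1/2..2} \<and>
     (\<forall>t\<ge>1. (\<lambda>j. (norm (a (t / 2 ^ j)))\<^sup>2) sums 1)"

definition orthant :: "(real^'n) set" where
  "orthant = {t. \<forall>i. 0 \<le> t $ i}"

definition proj :: "'n \<Rightarrow> real^'n \<Rightarrow> real^'n" where
  "proj k t = (\<chi> i. if i = k then 0 else t $ i)"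

definition norm_1 :: "real^'n \<Rightarrow> real" where
  "norm_1 t = (\<Sum>i\<in>UNIV. \<bar>t $ i\<bar>)"

definition B_1 :: "(real^'n) set" where
  "B_1 = {t \<in> orthant. norm_1 t \<le> 1}"

text \<open>The library's \<^const>\<open>infnorm\<close> is the maximum norm.\<close>

definition second_kind :: "(real^'n \<Rightarrow> 'b::real_normed_field) \<Rightarrow> bool" where
  "second_kind A \<longleftrightarrow>
     C_infinity_on orthant A \<and>
     supp_on orthant A \<subseteq> {t. \<forall>i. t $ i \<in> {0..2}} \<and>
     (\<forall>t\<in>orthant. \<forall>k. t $ k \<le> infnorm t / 2 \<longrightarrow> A t = A (proj k t))"

definition second_kind_a :: "(real^'n \<Rightarrow> 'b::real_normed_field) \<Rightarrow> bool" where
  "second_kind_a A \<longleftrightarrow> second_kind A \<and> (\<forall>t\<in>B_1. A t = 1)"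

definition second_kind_b :: "(real^'n \<Rightarrow> 'b::real_normed_field) \<Rightarrow> bool" where
  "second_kind_b A \<longleftrightarrow> second_kind A \<and> (\<forall>t\<in>(\<lambda>t. (1/2) *\<^sub>R t) ` B_1. A t = 0)"

definition second_kind_c :: "(real^'n \<Rightarrow> 'b::real_normed_field) \<Rightarrow> bool" where
  "second_kind_c A \<longleftrightarrow> second_kind_b A \<and>
     (\<forall>t \<in> orthant - {t. \<forall>i. t $ i \<in> {0..<1}}.
        (\<lambda>j. (norm (A ((1 / 2 ^ j) *\<^sub>R t)))\<^sup>2) sums 1)"

text \<open>
  The case distinction on \<open>t $ m\<close> implements the convention \<open>c (\<tau> / 0) = 0\<close>, which does not follow
  from \<open>\<tau> / 0 = 0\<close> since \<open>c 0 = 1\<close> for the functions \<open>c\<close> of interest.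
\<close>

definition N_fun :: "(real \<Rightarrow> real) \<Rightarrow> real^'n \<Rightarrow> real" where
  "N_fun c t =
     (if t = 0 then 0
      else (\<Sum>m\<in>UNIV. \<bar>t $ m\<bar> * (\<Prod>j\<in>UNIV. if t $ m = 0 then 0 else c (t $ j / t $ m))))"

end

theory Submission imports Defs begin

text \<open>
  On the orthant, write \<open>N = N_fun c\<close> as the sum of the terms
  \<open>N\<^sub>m t = t\<^sub>m * (\<Prod>j. c (t\<^sub>j / t\<^sub>m))\<close>. Everything rests on two observations.
  A coordinate that is at most half as large as some other one contributes nothing, since
  the factor of that other coordinate vanishes (\<open>N_term_eq_0\<close>). Conversely, a factor
  \<open>c (t\<^sub>j / t\<^sub>m)\<close> equals \<open>1\<close> as soon as \<open>t\<^sub>j \<le> t\<^sub>m\<close>, so that the largest coordinate contributes its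
  full value (\<open>N_term_max\<close>).

  As all factors lie between \<open>0\<close> and \<open>1\<close>, this sandwiches \<open>N\<close> between the maximum norm and the
  \<open>1\<close>-norm. The lower bound controls the support of \<open>a \<circ> N\<close>; the upper bound gives its values near
  the origin. Since \<open>N\<close> is also homogeneous of degree one, the sum in type (c) at \<open>t\<close> is
  the univariate sum at \<open>N t \<ge> 1\<close>. Replacing a coordinate
  \<open>t\<^sub>k \<le> infnorm t / 2\<close> by \<open>0\<close> does not change \<open>N\<close>: the term \<open>N\<^sub>k\<close> vanishes anyway, and in a term
  \<open>N\<^sub>m\<close> that does not vanish \<open>t\<^sub>m\<close> exceeds half the maximum, so the factor that depends on
  \<open>t\<^sub>k\<close> is \<open>1\<close> before and after the replacement (\<open>N_fun_proj\<close>).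

  The delicate point is smoothness, because \<open>t\<^sub>j / t\<^sub>m\<close> is singular at \<open>t\<^sub>m = 0\<close>. Where \<open>t\<^sub>m > 0\<close>,
  the term \<open>N\<^sub>m\<close> is a composition of smooth functions; at a point \<open>t \<noteq> 0\<close> with \<open>t\<^sub>m = 0\<close>, some
  other coordinate is positive and \<open>N\<^sub>m\<close> vanishes in a whole neighbourhood
  (\<open>C_k_on_N_term\<close>). So \<open>N\<close> is smooth away from the origin. Near the origin \<open>N\<close> is in general not
  smooth, but there \<open>a \<circ> N\<close> is constant: \<open>a\<close> is constant on some interval \<open>[0, r]\<close> in each of
  the three cases, and \<open>N\<close> is bounded by the \<open>1\<close>-norm.

  Gluing these local descriptions requires that being \<open>C\<^sup>k\<close> relative to a set is a local
  property. With the derivative given by an existential quantifier, this depends on the derivative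
  being unique (\<open>C_k_on_local\<close>).
\<close>

section \<open>Calculus of relative \<open>C\<^sup>k\<close> functions\<close>

lemma C_k_on_cong:
  assumes "\<And>x. x \<in> S \<Longrightarrow> f x = g x"
  shows "C_k_on k S f \<longleftrightarrow> C_k_on k S g"
proof (cases k)
  case 0
  then show ?thesis using continuous_on_cong[OF refl assms] by simp
next
  case (Suc k')
  have fg: "(g has_derivative D) (at x within S)"
    if "x \<in> S" "(f has_derivative D) (at x within S)" for x D
    using that assms by (intro has_derivative_transform[where f = f and g = g]) auto
  have gf: "(f has_derivative D) (at x within S)"
    if "x \<in> S" "(g has_derivative D) (at x within S)" for x D
    using that assms by (intro has_derivative_transform[where f = g and g = f]) auto
  show ?thesis unfolding Suc C_k_on.simps by (meson fg gf)
qed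

lemma C_k_on_Suc_imp: "C_k_on (Suc k) S f \<Longrightarrow> C_k_on k S f"
proof (induction k arbitrary: f)
  case 0
  then obtain f' where "\<forall>x\<in>S. (f has_derivative f' x) (at x within S)" by auto
  then show ?case using has_derivative_continuous_on[of S f f'] by simp
next
  case (Suc k)
  then obtain f' where "\<forall>x\<in>S. (f has_derivative f' x) (at x within S)"
    and "\<forall>i\<in>Basis. C_k_on (Suc k) S (\<lambda>x. f' x i)" by auto
  with Suc.IH show ?case by auto
qed

lemma C_k_on_const: "C_k_on k S (\<lambda>x. v)"
proof (induction k arbitrary: v)
  case (Suc k)
  then show ?case by (auto intro!: exI[of _ "\<lambda>x h. 0"])
qed simp

lemma C_k_on_linear:
  assumes "bounded_linear f"
  shows "C_k_on k S f"
proof (cases k)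
  case 0
  then show ?thesis using assms by (simp add: linear_continuous_on)
next
  case (Suc k')
  then show ?thesis
    using assms by (auto intro!: exI[of _ "\<lambda>x. f"] C_k_on_const bounded_linear_imp_has_derivative)
qed

lemma C_k_on_add: "C_k_on k S f \<Longrightarrow> C_k_on k S g \<Longrightarrow> C_k_on k S (\<lambda>x. f x + g x)"
proof (induction k arbitrary: f g)
  case 0
  then show ?case by (auto intro: continuous_intros)
next
  case (Suc k)
  obtain f' where "\<forall>x\<in>S. (f has_derivative f' x) (at x within S)"
    and "\<forall>i\<in>Basis. C_k_on k S (\<lambda>x. f' x i)" using Suc.prems(1) by auto
  moreover obtain g' where "\<forall>x\<in>S. (g has_derivative g' x) (at x within S)"
    and "\<forall>i\<in>Basis. C_k_on k S (\<lambda>x. g' x i)" using Suc.prems(2) by auto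
  ultimately show ?case
    using Suc.IH by (auto intro!: exI[of _ "\<lambda>x h. f' x h + g' x h"] has_derivative_add)
qed

text \<open>
  The second factor is vector-valued because the derivative of a composition
  is such a product; the claim follows from the Leibniz rule
  by induction, since \<open>f\<close> and \<open>g\<close> have the order of smoothness of their derivatives as well.
\<close>

lemma C_k_on_scaleR:
  fixes f :: "'a::euclidean_space \<Rightarrow> real"
  shows "C_k_on k S f \<Longrightarrow> C_k_on k S g \<Longrightarrow> C_k_on k S (\<lambda>x. f x *\<^sub>R g x)"
proof (induction k arbitrary: f g)
  case 0
  then show ?case by (auto intro: continuous_intros)
next
  case (Suc k)
  obtain f' where f': "\<forall>x\<in>S. (f has_derivative f' x) (at x within S)"
    "\<forall>i\<in>Basis. C_k_on k S (\<lambda>x. f' x i)" using Suc.prems(1) by auto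
  obtain g' where g': "\<forall>x\<in>S. (g has_derivative g' x) (at x within S)"
    "\<forall>i\<in>Basis. C_k_on k S (\<lambda>x. g' x i)" using Suc.prems(2) by auto
  have "\<forall>x\<in>S. ((\<lambda>x. f x *\<^sub>R g x) has_derivative (\<lambda>h. f x *\<^sub>R g' x h + f' x h *\<^sub>R g x)) (at x within S)"
    using f' g' by (auto intro: has_derivative_scaleR)
  moreover have "\<forall>i\<in>Basis. C_k_on k S (\<lambda>x. f x *\<^sub>R g' x i + f' x i *\<^sub>R g x)"
    using f' g' Suc.prems by (auto intro!: C_k_on_add Suc.IH intro: C_k_on_Suc_imp simp del: C_k_on.simps)
  ultimately show ?case
    unfolding C_k_on.simps by (intro exI[of _ "\<lambda>x h. f x *\<^sub>R g' x h + f' x h *\<^sub>R g x"]) simp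
qed

lemma C_k_on_sum:
  "(\<And>i. i \<in> I \<Longrightarrow> C_k_on k S (f i)) \<Longrightarrow> C_k_on k S (\<lambda>x. \<Sum>i\<in>I. f i x)"
  by (induction I rule: infinite_finite_induct) (auto intro: C_k_on_const C_k_on_add)

lemma C_k_on_prod:
  fixes f :: "'i \<Rightarrow> 'a::euclidean_space \<Rightarrow> real"
  shows "(\<And>i. i \<in> I \<Longrightarrow> C_k_on k S (f i)) \<Longrightarrow> C_k_on k S (\<lambda>x. \<Prod>i\<in>I. f i x)"
proof (induction I rule: infinite_finite_induct)
  case (insert i I)
  then have "C_k_on k S (\<lambda>x. f i x *\<^sub>R (\<Prod>i\<in>I. f i x))"
    by (intro C_k_on_scaleR) auto
  with insert.hyps show ?case by simp
qed (auto intro: C_k_on_const)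

text \<open>
  The inner function is real, so the outer derivative is multiplication by the single vector
  \<open>g' (f x) 1\<close>. Hence the derivative of the composition is a product of a partial
  derivative of \<open>f\<close> and a composition with \<open>f\<close>, to which the induction hypothesis applies.
\<close>

lemma C_k_on_compose:
  fixes f :: "'a::euclidean_space \<Rightarrow> real"
  shows "C_k_on k T g \<Longrightarrow> C_k_on k S f \<Longrightarrow> f ` S \<subseteq> T \<Longrightarrow> C_k_on k S (\<lambda>x. g (f x))"
proof (induction k arbitrary: g)
  case 0
  then show ?case by (auto intro: continuous_on_compose2)
next
  case (Suc k)
  obtain f' where f': "\<forall>x\<in>S. (f has_derivative f' x) (at x within S)"
    "\<forall>i\<in>Basis. C_k_on k S (\<lambda>x. f' x i)" using Suc.prems by auto
  obtain g' where g': "\<forall>x\<in>T. (g has_derivative g' x) (at x within T)"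
    "C_k_on k T (\<lambda>x. g' x 1)" using Suc.prems(1) by auto
  have "((\<lambda>x. g (f x)) has_derivative (\<lambda>h. f' x h *\<^sub>R g' (f x) 1)) (at x within S)" if "x \<in> S" for x
  proof -
    have "((\<lambda>x. g (f x)) has_derivative (\<lambda>h. g' (f x) (f' x h))) (at x within S)"
      using has_derivative_in_compose2[of T g g' f S x "f' x"] that f' g' Suc.prems(3) by auto
    moreover have "linear (g' (f x))"
      using g' that Suc.prems(3) has_derivative_linear by blast
    then have "g' (f x) r = r *\<^sub>R g' (f x) 1" for r
      using linear_scale[of "g' (f x)" r 1] by simp
    then have "(\<lambda>h. g' (f x) (f' x h)) = (\<lambda>h. f' x h *\<^sub>R g' (f x) 1)" by blast
    ultimately show ?thesis by simp
  qed
  moreover have "\<forall>i\<in>Basis. C_k_on k S (\<lambda>x. f' x i *\<^sub>R g' (f x) 1)"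
    using f'(2) Suc.IH[OF g'(2) C_k_on_Suc_imp[OF Suc.prems(2)] Suc.prems(3)]
    by (intro ballI C_k_on_scaleR) blast+
  ultimately show ?case
    unfolding C_k_on.simps by (intro exI[of _ "\<lambda>x h. f' x h *\<^sub>R g' (f x) 1"]) simp
qed

lemma C_k_on_inverse: "C_k_on k {0<..} (inverse :: real \<Rightarrow> real)"
proof (induction k)
  case 0
  then show ?case by (auto intro!: continuous_intros)
next
  case (Suc k)
  have "\<forall>x::real\<in>{0<..}. (inverse has_derivative (\<lambda>h. - (inverse x * h * inverse x)))
          (at x within {0<..})"
    by (intro ballI has_derivative_inverse') auto
  moreover have "C_k_on k {0<..} (\<lambda>x::real. (-1) *\<^sub>R (inverse x *\<^sub>R inverse x))"
    by (intro C_k_on_scaleR C_k_on_const Suc)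
  ultimately show ?case
    unfolding C_k_on.simps
    by (intro exI[of _ "\<lambda>x h. - (inverse x * h * inverse x)"]) auto
qed

section \<open>Smoothness is a local property\<close>

text \<open>
  Each point of such a set has nearby points of the set on every line through it that is parallel
  to an axis, which is what makes derivatives relative to the set unique.
\<close>

definition axially_thick :: "'a::euclidean_space set \<Rightarrow> bool" where
  "axially_thick S \<longleftrightarrow>
     (\<forall>x\<in>S. \<forall>i\<in>Basis. \<forall>e>0. \<exists>d. 0 < \<bar>d\<bar> \<and> \<bar>d\<bar> < e \<and> x + d *\<^sub>R i \<in> S)"

lemma axially_thick_Int_open:
  assumes "axially_thick S" "open U"
  shows "axially_thick (S \<inter> U)"
  unfolding axially_thick_def
proof (intro ballI allI impI)
  fix x i :: 'a and e :: real
  assume "x \<in> S \<inter> U" "i \<in> Basis" "0 < e"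
  obtain r where r: "r > 0" "ball x r \<subseteq> U"
    using \<open>x \<in> S \<inter> U\<close> \<open>open U\<close> open_contains_ball by blast
  obtain d where d: "0 < \<bar>d\<bar>" "\<bar>d\<bar> < min e r" "x + d *\<^sub>R i \<in> S"
    using assms(1) \<open>x \<in> S \<inter> U\<close> \<open>i \<in> Basis\<close> \<open>0 < e\<close> r(1)
    unfolding axially_thick_def by (metis IntD1 min_less_iff_conj)
  have "x + d *\<^sub>R i \<in> U"
    using d r \<open>i \<in> Basis\<close> by (auto simp: dist_norm)
  then show "\<exists>d. 0 < \<bar>d\<bar> \<and> \<bar>d\<bar> < e \<and> x + d *\<^sub>R i \<in> S \<inter> U" using d by auto
qed

text \<open>
  Choose for every \<open>x\<close> a derivative \<open>f' x\<close> valid on a neighbourhood \<open>U x\<close> and glue along the diagonal: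
  \<open>\<lambda>y. f' y y\<close>. By uniqueness this agrees on \<open>U x\<close> with \<open>f' x\<close>, whose partial derivatives are
  known to be \<open>C\<^sup>k\<close>; without uniqueness the unrelated choices at different points need not fit
  together continuously.
\<close>

lemma C_k_on_local:
  assumes "axially_thick S"
  shows "(\<And>x. x \<in> S \<Longrightarrow> \<exists>U. open U \<and> x \<in> U \<and> C_k_on k (S \<inter> U) f) \<Longrightarrow> C_k_on k S f"
proof (induction k arbitrary: f)
  case 0
  have "continuous (at x within S) f" if x: "x \<in> S" for x
  proof -
    obtain U where "open U" "x \<in> U" "continuous_on (S \<inter> U) f" using 0[OF x] by auto
    moreover have "at x within S \<inter> U = at x within S"
      using \<open>open U\<close> \<open>x \<in> U\<close> by (intro at_within_nhd[of _ U]) auto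
    ultimately show ?thesis
      using x by (metis IntI continuous_on_eq_continuous_within)
  qed
  then show ?case by (simp add: continuous_on_eq_continuous_within)
next
  case (Suc k)
  have "\<exists>U f'. open U \<and> x \<in> U \<and> (\<forall>y\<in>S \<inter> U. (f has_derivative f' y) (at y within S)) \<and>
          (\<forall>i\<in>Basis. C_k_on k (S \<inter> U) (\<lambda>y. f' y i))" if x: "x \<in> S" for x
  proof -
    obtain U f' where "open U" "x \<in> U"
      and f': "\<forall>y\<in>S \<inter> U. (f has_derivative f' y) (at y within S \<inter> U)"
        "\<forall>i\<in>Basis. C_k_on k (S \<inter> U) (\<lambda>y. f' y i)" using Suc.prems[OF x] by auto
    moreover have "at y within S \<inter> U = at y within S" if "y \<in> S \<inter> U" for y
      using that \<open>open U\<close> by (intro at_within_nhd[of _ U]) auto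
    ultimately show ?thesis by (intro exI[of _ U] exI[of _ f']) auto
  qed
  then obtain U f' where U: "\<And>x. x \<in> S \<Longrightarrow> open (U x) \<and> x \<in> U x"
    and der: "\<And>x y. x \<in> S \<Longrightarrow> y \<in> S \<inter> U x \<Longrightarrow> (f has_derivative f' x y) (at y within S)"
    and Ck: "\<And>x i. x \<in> S \<Longrightarrow> i \<in> Basis \<Longrightarrow> C_k_on k (S \<inter> U x) (\<lambda>y. f' x y i)"
    by metis
  have uniq: "f' y y = f' x y" if "x \<in> S" "y \<in> S \<inter> U x" for x y
  proof (rule frechet_derivative_unique_within)
    show "(f has_derivative f' y y) (at y within S)" using der U that by blast
    show "(f has_derivative f' x y) (at y within S)" using der that by blast
  qed (use assms that in \<open>auto simp: axially_thick_def\<close>)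
  have "C_k_on k S (\<lambda>y. f' y y i)" if i: "i \<in> Basis" for i
  proof (rule Suc.IH)
    fix x assume x: "x \<in> S"
    have "C_k_on k (S \<inter> U x) (\<lambda>y. f' y y i)"
      using Ck[OF x i] uniq[OF x] by (subst C_k_on_cong[where g = "\<lambda>y. f' x y i"]) auto
    then show "\<exists>U. open U \<and> x \<in> U \<and> C_k_on k (S \<inter> U) (\<lambda>y. f' y y i)" using U[OF x] by blast
  qed
  then show ?case using der U by (auto intro!: exI[of _ "\<lambda>y. f' y y"])
qed

lemma axially_thick_orthant: "axially_thick (orthant :: (real^'n) set)"
  unfolding axially_thick_def
proof (intro ballI allI impI)
  fix x i :: "real^'n" and e :: real
  assume "x \<in> orthant" "i \<in> Basis" "0 < e"
  then have "x + (e/2) *\<^sub>R i \<in> orthant"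
    by (auto simp: orthant_def Basis_vec_def axis_def)
  with \<open>0 < e\<close> show "\<exists>d. 0 < \<bar>d\<bar> \<and> \<bar>d\<bar> < e \<and> x + d *\<^sub>R i \<in> orthant"
    by (intro exI[of _ "e/2"]) auto
qed

section \<open>Values of admissible functions\<close>

lemma zero_outside_supp_on: "supp_on S f \<subseteq> T \<Longrightarrow> t \<in> S \<Longrightarrow> t \<notin> T \<Longrightarrow> f t = 0"
  using closure_subset[of "{t \<in> S. f t \<noteq> 0}"] by (auto simp: supp_on_def)

lemma admissible_continuous_on: "admissible a \<Longrightarrow> continuous_on {0..} a"
  unfolding admissible_def C_infinity_on_def by (metis C_k_on.simps(1))

text \<open>
  The conditions on supports leave open the values at the end points \<open>1/2\<close> and \<open>2\<close>, where the
  functions vanish by continuity.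
\<close>

lemma eq_0_by_continuity:
  fixes f :: "real \<Rightarrow> 'b::real_normed_vector"
  assumes f: "continuous_on {u..v} f" and "u < v" "t \<in> {u..v}"
    and "\<And>s. s \<in> {u<..<v} \<Longrightarrow> f s = 0"
  shows "f t = 0"
  using continuous_constant_on_closure[of "{u<..<v}" f 0 t] assms by simp

lemma admissible_c_imp_b: "admissible_c a \<Longrightarrow> admissible_b a"
  unfolding admissible_c_def admissible_b_def by blast

lemma admissible_a_zero:
  assumes "admissible_a c" "2 \<le> s"
  shows "c s = 0"
proof (rule eq_0_by_continuity[of 2 "s + 1" c])
  have "continuous_on {0..} c"
    using assms admissible_a_def admissible_continuous_on by blast
  then show "continuous_on {2..s + 1} c"
    by (rule continuous_on_subset) auto
  show "c r = 0" if "r \<in> {2<..<s+1}" for r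
  proof (rule zero_outside_supp_on[of "{0..}" c "{0..2}"])
    show "supp_on {0..} c \<subseteq> {0..2}"
      using assms(1) unfolding admissible_a_def admissible_def by blast
  qed (use that in auto)
qed (use assms in auto)

lemma admissible_b_zero:
  assumes "admissible_b a" "s \<in> {0..1/2}"
  shows "a s = 0"
proof (rule eq_0_by_continuity[of 0 "1/2" a])
  have "continuous_on {0..} a"
    using assms admissible_b_def admissible_continuous_on by blast
  then show "continuous_on {0..1/2} a"
    by (rule continuous_on_subset) auto
  show "a r = 0" if "r \<in> {0<..<1/2}" for r
  proof (rule zero_outside_supp_on[of "{0..}" a "{1/2..2}"])
    show "supp_on {0..} a \<subseteq> {1/2..2}"
      using assms(1) unfolding admissible_b_def by blast
  qed (use that in auto)
qed (use assms in auto)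

section \<open>The homogeneous function \<open>N_fun c\<close>\<close>

lemma infnorm_attained:
  fixes t :: "real^'n"
  obtains k where "\<bar>t $ k\<bar> = infnorm t"
proof -
  have "infnorm t \<in> (\<lambda>i. \<bar>t \<bullet> i\<bar>) ` Basis"
    unfolding infnorm_Max by (intro Max_in) auto
  then obtain k where "infnorm t = \<bar>t \<bullet> axis k 1\<bar>"
    by (auto simp: Basis_vec_def)
  then show ?thesis using that by (simp add: inner_axis)
qed

text \<open>
  If \<open>t $ m = 0\<close>, the term vanishes because of its factor \<open>t $ m\<close>, in accordance with the convention
  \<open>c (\<tau> / 0) = 0\<close>.
\<close>

definition N_term :: "(real \<Rightarrow> real) \<Rightarrow> 'n \<Rightarrow> real^'n \<Rightarrow> real" where
  "N_term c m t = t $ m * (\<Prod>j\<in>UNIV. c (t $ j / t $ m))"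

lemma N_fun_eq_sum_N_term:
  assumes "t \<in> orthant"
  shows "N_fun c t = (\<Sum>m\<in>UNIV. N_term c m t)"
proof (cases "t = 0")
  case False
  have "\<bar>t $ m\<bar> * (\<Prod>j\<in>UNIV. if t $ m = 0 then 0 else c (t $ j / t $ m)) = N_term c m t" for m
    using assms by (cases "t $ m = 0") (auto simp: N_term_def orthant_def)
  then show ?thesis using False by (simp add: N_fun_def)
qed (simp add: N_fun_def N_term_def)

lemma scaleR_in_orthant: "t \<in> orthant \<Longrightarrow> 0 \<le> r \<Longrightarrow> r *\<^sub>R t \<in> orthant"
  by (simp add: orthant_def)

lemma N_fun_scaleR:
  assumes "t \<in> orthant" "0 < r"
  shows "N_fun c (r *\<^sub>R t) = r * N_fun c t"
proof -
  have "N_term c m (r *\<^sub>R t) = r * N_term c m t" for m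
    using assms by (simp add: N_term_def)
  then show ?thesis
    using assms by (simp add: N_fun_eq_sum_N_term scaleR_in_orthant sum_distrib_left)
qed

text \<open>
  These are the pointwise properties of \<open>c\<close> on which the estimates for \<open>N_fun c\<close> depend; smoothness
  is assumed separately where it is needed.
\<close>

locale cutoff_profile =
  fixes c :: "real \<Rightarrow> real"
  assumes one: "s \<in> {0..1} \<Longrightarrow> c s = 1"
    and zero: "2 \<le> s \<Longrightarrow> c s = 0"
    and nonneg: "0 \<le> c s"
    and le_one: "c s \<le> 1"
begin

text \<open>
  The factor with index \<open>k\<close> vanishes since \<open>t $ k / t $ m \<ge> 2\<close>. The case \<open>t $ m = 0\<close> is included,
  and also \<open>k = m\<close>, where the hypothesis forces \<open>t $ m = 0\<close>.
\<close>

lemma N_term_eq_0: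
  assumes "t \<in> orthant" "2 * t $ m \<le> t $ k"
  shows "N_term c m t = 0"
proof (cases "t $ m = 0")
  case False
  then have "0 < t $ m" using assms(1) by (simp add: orthant_def less_le)
  then have "c (t $ k / t $ m) = 0" using assms(2) by (intro zero) (simp add: field_simps)
  then show ?thesis by (auto simp: N_term_def)
qed (simp add: N_term_def)

lemma N_term_nonneg: "t \<in> orthant \<Longrightarrow> 0 \<le> N_term c m t"
  by (simp add: N_term_def orthant_def prod_nonneg nonneg)

lemma N_term_le: "t \<in> orthant \<Longrightarrow> N_term c m t \<le> t $ m"
  unfolding N_term_def
  by (intro mult_left_le prod_le_1) (auto simp: orthant_def nonneg le_one)

lemma N_term_max:
  assumes "t \<in> orthant" "\<And>j. t $ j \<le> t $ m"
  shows "N_term c m t = t $ m"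
proof (cases "t $ m = 0")
  case False
  then have "0 < t $ m" using assms(1) by (simp add: orthant_def less_le)
  then have "c (t $ j / t $ m) = 1" for j
    using assms by (intro one) (auto simp: orthant_def)
  then show ?thesis by (simp add: N_term_def)
qed (simp add: N_term_def)

lemma N_fun_nonneg: "t \<in> orthant \<Longrightarrow> 0 \<le> N_fun c t"
  by (simp add: N_fun_eq_sum_N_term sum_nonneg N_term_nonneg)

lemma N_fun_le_norm_1: "t \<in> orthant \<Longrightarrow> N_fun c t \<le> norm_1 t"
  unfolding N_fun_eq_sum_N_term norm_1_def
  by (intro sum_mono) (meson N_term_le abs_ge_self order_trans)

lemma infnorm_le_N_fun:
  assumes "t \<in> orthant"
  shows "infnorm t \<le> N_fun c t"
proof -
  obtain m where "\<bar>t $ m\<bar> = infnorm t" by (rule infnorm_attained)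
  with assms have m: "t $ m = infnorm t" by (simp add: orthant_def)
  have "infnorm t = N_term c m t"
    using N_term_max[OF assms, of m] m component_le_infnorm_cart[of t] by (metis abs_le_D1)
  also have "\<dots> \<le> N_fun c t"
    unfolding N_fun_eq_sum_N_term[OF assms]
    by (intro member_le_sum) (auto simp: N_term_nonneg assms)
  finally show ?thesis .
qed

lemma component_le_N_fun: "t \<in> orthant \<Longrightarrow> t $ k \<le> N_fun c t"
  by (meson abs_le_D1 component_le_infnorm_cart infnorm_le_N_fun order_trans)

lemma N_fun_proj:
  assumes t: "t \<in> orthant" and k: "t $ k \<le> infnorm t / 2"
  shows "N_fun c (proj k t) = N_fun c t"
proof -
  obtain M where "\<bar>t $ M\<bar> = infnorm t" by (rule infnorm_attained)
  with t have M: "2 * t $ k \<le> t $ M" using k by (simp add: orthant_def)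
  have p: "proj k t \<in> orthant" using t by (simp add: orthant_def proj_def)
  have "N_term c m (proj k t) = N_term c m t" for m
  proof -
    \<comment> \<open>The three cases are: the term of the replaced coordinate, which vanishes by
      \<open>N_term_eq_0\<close>; a term that vanishes because of the maximal coordinate \<open>M\<close>; and a
      term with \<open>t $ m\<close> so large that the factor of the coordinate \<open>k\<close> is \<open>1\<close>.\<close>
    consider "m = k" | "m \<noteq> k" "2 * t $ m \<le> t $ M" | "m \<noteq> k" "t $ M < 2 * t $ m" by linarith
    then show ?thesis
    proof cases
      case 1
      with N_term_eq_0[OF t M] show ?thesis by (simp add: N_term_def proj_def)
    next
      case 2
      show ?thesis
      proof (cases "M = k")
        \<comment> \<open>Here the maximal coordinate is the small one, which happens only for \<open>t = 0\<close>.\<close>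
        case True
        have "0 \<le> t $ m" "0 \<le> t $ M" using t by (simp_all add: orthant_def)
        with True M 2 have "t $ m = 0" by simp
        with 2 show ?thesis by (simp add: N_term_def proj_def)
      next
        case False
        with 2 have "2 * proj k t $ m \<le> proj k t $ M" by (simp add: proj_def)
        then show ?thesis using N_term_eq_0[OF t] N_term_eq_0[OF p] 2 by metis
      qed
    next
      case 3
      then have "t $ k \<le> t $ m" "0 \<le> t $ k" "0 \<le> t $ m" using M t by (auto simp: orthant_def)
      then have "c (t $ k / t $ m) = c 0" using one[of 0] by (subst one) (auto simp: divide_le_eq_1)
      then have "c (proj k t $ j / proj k t $ m) = c (t $ j / t $ m)" for j
        using 3 by (simp add: proj_def)
      then show ?thesis using 3 by (simp add: N_term_def proj_def)
    qed
  qed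
  then show ?thesis using t p by (simp add: N_fun_eq_sum_N_term)
qed

text \<open>
  The quotients \<open>t $ j / t $ m\<close> are smooth where \<open>t $ m > 0\<close>. Around a point \<open>t \<noteq> 0\<close> with
  \<open>t $ m = 0\<close>, some coordinate \<open>M\<close> is more than twice as large as the coordinate \<open>m\<close>, so
  that the term is identically \<open>0\<close> there.
\<close>

lemma C_k_on_N_term:
  fixes m :: "'n::finite"
  assumes "C_k_on k {0..} c"
  shows "C_k_on k (orthant - {0}) (N_term c m)"
proof (rule C_k_on_local)
  show "axially_thick (orthant - {0} :: (real^'n) set)"
    unfolding Diff_eq by (intro axially_thick_Int_open axially_thick_orthant open_Compl closed_singleton)
  fix t :: "real^'n" assume t: "t \<in> orthant - {0}"
  show "\<exists>U. open U \<and> t \<in> U \<and> C_k_on k ((orthant - {0}) \<inter> U) (N_term c m)"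
  proof (cases "t $ m = 0")
    case True
    obtain M where "t $ M \<noteq> 0" using t by (auto simp: vec_eq_iff)
    with t have "0 < t $ M" by (simp add: orthant_def less_le)
    define U where "U = {u :: real^'n. 2 * u $ m < u $ M}"
    have "open U" unfolding U_def by (intro open_Collect_less continuous_intros)
    moreover have "t \<in> U" using True \<open>0 < t $ M\<close> by (simp add: U_def)
    moreover have "C_k_on k ((orthant - {0}) \<inter> U) (N_term c m)"
      by (subst C_k_on_cong[where g = "\<lambda>_. 0"])
        (auto simp: U_def intro!: C_k_on_const N_term_eq_0[of _ _ M])
    ultimately show ?thesis by blast
  next
    case False
    with t have "0 < t $ m" by (simp add: orthant_def less_le)
    define U where "U = {u :: real^'n. 0 < u $ m}"
    define S where "S = (orthant - {0}) \<inter> U"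
    have "open U" unfolding U_def by (intro open_Collect_less continuous_intros)
    moreover have "t \<in> U" using \<open>0 < t $ m\<close> by (simp add: U_def)
    moreover have "C_k_on k S (N_term c m)"
    proof -
      have coord: "C_k_on k S (\<lambda>u. u $ j)" for j
        by (intro C_k_on_linear bounded_linear_vec_nth)
      have "C_k_on k S (\<lambda>u. inverse (u $ m))"
        by (rule C_k_on_compose[OF C_k_on_inverse coord]) (auto simp: S_def U_def)
      then have "C_k_on k S (\<lambda>u. u $ j *\<^sub>R inverse (u $ m))" for j
        by (intro C_k_on_scaleR coord)
      then have "C_k_on k S (\<lambda>u. c (u $ j *\<^sub>R inverse (u $ m)))" for j
        by (rule C_k_on_compose[OF assms]) (auto simp: S_def orthant_def)
      then have "C_k_on k S (\<lambda>u. u $ m *\<^sub>R (\<Prod>j\<in>UNIV. c (u $ j *\<^sub>R inverse (u $ m))))"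
        by (intro C_k_on_scaleR C_k_on_prod coord)
      then show ?thesis
        by (simp add: N_term_def[abs_def] divide_inverse)
    qed
    ultimately show ?thesis unfolding S_def by blast
  qed
qed

lemma C_k_on_N_fun:
  assumes "C_k_on k {0..} c"
  shows "C_k_on k (orthant - {0}) (N_fun c)"
proof -
  have "C_k_on k (orthant - {0}) (\<lambda>t. \<Sum>m\<in>UNIV. N_term c m t)"
    by (intro C_k_on_sum C_k_on_N_term assms)
  then show ?thesis
    by (subst C_k_on_cong[where g = "\<lambda>t. \<Sum>m\<in>UNIV. N_term c m t"]) (auto simp: N_fun_eq_sum_N_term)
qed

text \<open>
  At the origin, where \<open>N_fun c\<close> itself need not be differentiable, smoothness comes from \<open>a\<close>
  being constant on \<open>[0, r]\<close>: the region in which the \<open>1\<close>-norm is less than \<open>r\<close> is mapped into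
  this interval.
\<close>

lemma C_k_on_compose_N_fun:
  fixes a :: "real \<Rightarrow> 'b::real_normed_vector"
  assumes c: "C_k_on k {0..} c" and a: "C_k_on k {0..} a"
    and "0 < r" and v: "\<And>s. s \<in> {0..r} \<Longrightarrow> a s = v"
  shows "C_k_on k (orthant :: (real^'n) set) (\<lambda>t. a (N_fun c t))"
proof (rule C_k_on_local[OF axially_thick_orthant])
  fix t :: "real^'n" assume t: "t \<in> orthant"
  show "\<exists>U. open U \<and> t \<in> U \<and> C_k_on k (orthant \<inter> U) (\<lambda>t. a (N_fun c t))"
  proof (cases "t = 0")
    case True
    define U where "U = {u :: real^'n. norm_1 u < r}"
    have "open U" unfolding U_def norm_1_def by (intro open_Collect_less continuous_intros)
    moreover have "t \<in> U" using True \<open>0 < r\<close> by (simp add: U_def norm_1_def)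
    moreover have "a (N_fun c u) = v" if "u \<in> orthant \<inter> U" for u
      using that N_fun_nonneg[of u] N_fun_le_norm_1[of u] by (intro v) (auto simp: U_def)
    then have "C_k_on k (orthant \<inter> U) (\<lambda>t. a (N_fun c t))"
      by (subst C_k_on_cong[where g = "\<lambda>_. v"]) (auto intro: C_k_on_const)
    ultimately show ?thesis by blast
  next
    case False
    have "C_k_on k (orthant - {0} :: (real^'n) set) (\<lambda>t. a (N_fun c t))"
      by (rule C_k_on_compose[OF a C_k_on_N_fun[OF c]]) (auto simp: N_fun_nonneg)
    then have "C_k_on k (orthant \<inter> - {0} :: (real^'n) set) (\<lambda>t. a (N_fun c t))"
      by (simp only: Diff_eq)
    moreover have "open (- {0} :: (real^'n) set)" by (intro open_Compl closed_singleton)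
    ultimately show ?thesis using False by blast
  qed
qed

text \<open>
  This is the part common to all three types: \<open>v = 1\<close> and \<open>r = 1\<close> give type (a), \<open>v = 0\<close> and
  \<open>r = 1/2\<close> give types (b) and (c).
\<close>

lemma second_kind_compose_N_fun:
  fixes a :: "real \<Rightarrow> 'b::real_normed_field" and A :: "real^'n \<Rightarrow> 'b"
  assumes c: "C_infinity_on {0..} c" and a: "admissible a"
    and "0 < r" and v: "\<And>s. s \<in> {0..r} \<Longrightarrow> a s = v"
    and A: "\<And>t. t \<in> orthant \<Longrightarrow> A t = a (N_fun c t)"
  shows "second_kind A"
  unfolding second_kind_def
proof (intro conjI ballI allI impI)
  show "C_infinity_on orthant A"
    unfolding C_infinity_on_def
  proof
    fix k
    have "C_k_on k {0..} c" "C_k_on k {0..} a"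
      using c a by (auto simp: admissible_def C_infinity_on_def)
    then have "C_k_on k orthant (\<lambda>t. a (N_fun c t))"
      using \<open>0 < r\<close> v by (rule C_k_on_compose_N_fun)
    then show "C_k_on k orthant A" by (subst C_k_on_cong[OF A])
  qed
  show "supp_on orthant A \<subseteq> {t. \<forall>i. t $ i \<in> {0..2}}"
    unfolding supp_on_def
  proof (rule closure_minimal)
    show "closed {t :: real^'n. \<forall>i. t $ i \<in> {0..2}}"
      unfolding atLeastAtMost_iff
      by (intro closed_Collect_all closed_Collect_conj closed_Collect_le continuous_intros)
    have "t $ i \<le> 2" if "t \<in> orthant" "A t \<noteq> 0" for t :: "real^'n" and i
    proof (rule order_trans[OF component_le_N_fun[OF that(1)]])
      show "N_fun c t \<le> 2"
        using zero_outside_supp_on[of "{0..}" a "{0..2}" "N_fun c t"] a that A N_fun_nonneg[of t]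
        by (auto simp: admissible_def)
    qed
    then show "{t \<in> orthant. A t \<noteq> 0} \<subseteq> {t. \<forall>i. t $ i \<in> {0..2}}"
      by (auto simp: orthant_def)
  qed
next
  fix t :: "real^'n" and k assume t: "t \<in> orthant" "t $ k \<le> infnorm t / 2"
  have "proj k t \<in> orthant" using t by (simp add: orthant_def proj_def)
  with t show "A t = A (proj k t)" by (simp add: A N_fun_proj)
qed

end

theorem corollary3p8:
  fixes c :: "real \<Rightarrow> real"
    and a :: "real \<Rightarrow> 'b::real_normed_field"
    and A :: "real^'n \<Rightarrow> 'b"
  assumes "\<And>t. c (- t) = c t"
    and "admissible_a c"
    and "\<And>t. 0 \<le> c t \<and> c t \<le> 1"
    and "\<And>t. t \<in> orthant \<Longrightarrow> A t = a (N_fun c t)"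
  shows "(admissible_a a \<longrightarrow> second_kind_a A) \<and>
         (admissible_b a \<longrightarrow> second_kind_b A) \<and>
         (admissible_c a \<longrightarrow> second_kind_c A)"
proof -
  interpret cutoff_profile c
    using assms(2,3) by unfold_locales (auto simp: admissible_a_def admissible_a_zero[OF assms(2)])
  have c: "C_infinity_on {0..} c"
    using assms(2) by (simp add: admissible_a_def admissible_def)
  note A = assms(4)
  have a_case: "second_kind_a A" if "admissible_a a"
    unfolding second_kind_a_def
  proof (intro conjI ballI)
    have one: "a s = 1" if "s \<in> {0..1}" for s
      using \<open>admissible_a a\<close> that by (simp add: admissible_a_def)
    show "second_kind A"
    proof (rule second_kind_compose_N_fun[OF c _ zero_less_one])
      show "admissible a" using \<open>admissible_a a\<close> by (simp add: admissible_a_def)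
    qed (use one A in auto)
    show "A t = 1" if "t \<in> B_1" for t
      using that N_fun_nonneg[of t] N_fun_le_norm_1[of t] by (auto simp: B_1_def A intro!: one)
  qed
  have b_case: "second_kind_b A" if "admissible_b a"
    unfolding second_kind_b_def
  proof (intro conjI ballI)
    show "second_kind A"
    proof (rule second_kind_compose_N_fun[OF c])
      show "admissible a" using that by (simp add: admissible_b_def)
      show "0 < (1/2 :: real)" by simp
    qed (use admissible_b_zero[OF that] A in auto)
    fix t :: "real^'n" assume "t \<in> (\<lambda>t. (1/2) *\<^sub>R t) ` B_1"
    then obtain u where u: "u \<in> orthant" "norm_1 u \<le> 1" "t = (1/2) *\<^sub>R u"
      by (auto simp: B_1_def)
    then have "N_fun c t \<in> {0..1/2}"
      using N_fun_scaleR[of u "1/2" c] N_fun_nonneg[of u] N_fun_le_norm_1[of u] by auto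
    then have "a (N_fun c t) = 0" by (rule admissible_b_zero[OF that])
    then show "A t = 0" using u by (simp add: A scaleR_in_orthant)
  qed
  have c_case: "second_kind_c A" if "admissible_c a"
    unfolding second_kind_c_def
  proof (intro conjI ballI)
    show "second_kind_b A" using b_case admissible_c_imp_b that by blast
    fix t :: "real^'n" assume t: "t \<in> orthant - {t. \<forall>i. t $ i \<in> {0..<1}}"
    then obtain i where "1 \<le> t $ i" by (auto simp: orthant_def not_less)
    then have "1 \<le> N_fun c t" using component_le_N_fun[of t i] t by simp
    then have "(\<lambda>j. (norm (a (N_fun c t / 2 ^ j)))\<^sup>2) sums 1"
      using that by (simp add: admissible_c_def)
    moreover have "A ((1 / 2 ^ j) *\<^sub>R t) = a (N_fun c t / 2 ^ j)" for j
      using t N_fun_scaleR[of t "1 / 2 ^ j" c] by (simp add: A scaleR_in_orthant)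
    ultimately show "(\<lambda>j. (norm (A ((1 / 2 ^ j) *\<^sub>R t)))\<^sup>2) sums 1" by simp
  qed
  show ?thesis using a_case b_case c_case by blast
qed

end
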